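(* Let $p=5$ and $q=p^r$ with $r\ge1$. Let $\chi\in G(R_{3,q})\setminus G(R_{2,q})$. Then the roots of $L\left(\frac{u}{\sqrt q},\chi\right)$ (as a polynomial in $u$) are roots of unity of order dividing $60$.
   Context: $\mathcal{M}_q$ is the set of monic polynomials in $\mathbb{F}_q[T]$. The $j$-th next-to-leading coefficient of $f\in\mathcal{M}_q$ is the coefficient of $T^{\deg f-j}$ in $f$, taken to be $0$ if $j>\deg f$. For $\ell\in\mathbb{N}=\{0,1,2,\dots\}$, the equivalence relation $R_\ell=R_{\ell,q}$ on $\mathcal{M}_q$ is: $A\equiv B\bmod R_\ell$ iff $A$ and $B$ have the same first $\ell$ next-to-leading coefficients. The quotient $\mathcal{M}_q/R_\ell$ is an abelian group of order $q^\ell$ under polynomial multiplication, with identity the class of $1$. $G(R_\ell)=G(R_{\ell,q})$ denotes the set of functions $\mathcal{M}_q\to\mathbb{C}^\times$ obtained by composing a character of $\mathcal{M}_q/R_\ell$ with the projection $\mathcal{M}_q\to\mathcal{M}_q/R_\ell$; thus $G(R_{\ell-1})\subseteq G(R_\ell)$. The $L$-function of $\chi$ is the power series $L(u,\chi)=\sum_{f\in\mathcal{M}_q}\chi(f)u^{\deg f}$; for nontrivial $\chi\in G(R_\ell)$ it is a polynomial in $u$ of degree at most $\ell-1$. *)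

theory Defs
  imports Complex_Main "HOL-Library.Cardinality" "HOL-Algebra.Group" "HOL-Computational_Algebra.Polynomial_FPS"
begin

definition monic_polys :: "'a::{field,finite} poly set" where
  "monic_polys = {f. lead_coeff f = 1}"

definition next_coeff :: "nat \<Rightarrow> 'a::{field,finite} poly \<Rightarrow> 'a" where
  "next_coeff j f = (if j \<le> degree f then coeff f (degree f - j) else 0)"

definition short_rel :: "nat \<Rightarrow> ('a::{field,finite} poly \<times> 'a poly) set" where
  "short_rel l = {(A, B). A \<in> monic_polys \<and> B \<in> monic_polys \<and>
                    (\<forall>j\<in>{1..l}. next_coeff j A = next_coeff j B)}"

text \<open>The product of two classes is written as a union over all choices of representatives;
  by \<open>class_mult\<close> below it is the class of the product of any two of them.\<close>

definition class_group :: "nat \<Rightarrow> 'a::{field,finite} poly set monoid" where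
  "class_group l =
     \<lparr>carrier = monic_polys // short_rel l,
      monoid.mult = (\<lambda>X Y. \<Union>A\<in>X. \<Union>B\<in>Y. short_rel l `` {A * B}),
      monoid.one = short_rel l `` {1}\<rparr>"

definition complex_units :: "complex monoid" where
  "complex_units = \<lparr>carrier = UNIV - {0}, monoid.mult = (*), monoid.one = 1\<rparr>"

text \<open>A function on the monic polynomials is represented by a function on all polynomials that is
  \<^const>\<open>undefined\<close> off \<^const>\<open>monic_polys\<close>, so that equality means agreement on monic polynomials.\<close>

definition short_chars :: "nat \<Rightarrow> ('a::{field,finite} poly \<Rightarrow> complex) set" where
  "short_chars l =
     {compose monic_polys \<psi> (\<lambda>f. short_rel l `` {f}) | \<psi>. \<psi> \<in> hom (class_group l) complex_units}"

definition L_series :: "('a::{field,finite} poly \<Rightarrow> complex) \<Rightarrow> complex fps" where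
  "L_series \<chi> = Abs_fps (\<lambda>n. \<Sum>f | f \<in> monic_polys \<and> degree f = n. \<chi> f)"

lemma equiv_short_rel: "equiv monic_polys (short_rel l)"
proof (rule equivI)
  show "short_rel l \<subseteq> monic_polys \<times> monic_polys" "refl_on monic_polys (short_rel l)"
    unfolding short_rel_def refl_on_def by blast+
  show "sym (short_rel l)"
    unfolding short_rel_def sym_def by simp
  show "trans (short_rel l)"
    unfolding short_rel_def trans_def by simp
qed

lemma next_coeff_eq_reflect: "next_coeff j f = coeff (reflect_poly f) j"
  by (auto simp: next_coeff_def coeff_reflect_poly)

lemma short_rel_iff:
  "(A, B) \<in> short_rel l \<longleftrightarrow> A \<in> monic_polys \<and> B \<in> monic_polys \<and>
     (\<forall>j\<le>l. coeff (reflect_poly A) j = coeff (reflect_poly B) j)"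
proof -
  have "(\<forall>j\<in>{1..l}. P j) \<longleftrightarrow> (\<forall>j\<le>l. P j)" if "P 0" for P :: "nat \<Rightarrow> bool"
  proof (intro iffI allI impI ballI)
    fix j assume *: "\<forall>j\<in>{1..l}. P j" "j \<le> l"
    show "P j"
    proof (cases j)
      case 0
      with that show ?thesis by simp
    next
      case (Suc k)
      with * show ?thesis by simp
    qed
  qed simp
  note * = this[where P = "\<lambda>j. coeff (reflect_poly A) j = coeff (reflect_poly B) j"]
  show ?thesis
  proof (cases "A \<in> monic_polys \<and> B \<in> monic_polys")
    case True
    then have "coeff (reflect_poly A) 0 = coeff (reflect_poly B) 0"
      by (simp add: monic_polys_def)
    from *[OF this] True show ?thesis
      by (simp only: short_rel_def next_coeff_eq_reflect mem_Collect_eq case_prod_conv)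
  next
    case False
    then show ?thesis by (simp only: short_rel_def mem_Collect_eq case_prod_conv) blast
  qed
qed

lemma short_rel_mult:
  assumes "(A, A') \<in> short_rel l" "(B, B') \<in> short_rel l"
  shows "(A * B, A' * B') \<in> short_rel l"
proof -
  have "coeff (reflect_poly A * reflect_poly B) j = coeff (reflect_poly A' * reflect_poly B') j"
    if "j \<le> l" for j
    unfolding coeff_mult using assms that by (intro sum.cong) (auto simp: short_rel_iff)
  with assms show ?thesis
    by (auto simp: short_rel_iff reflect_poly_mult monic_polys_def lead_coeff_mult)
qed

lemma class_mult:
  assumes "A \<in> monic_polys" "B \<in> monic_polys"
  shows "(short_rel l `` {A}) \<otimes>\<^bsub>class_group l\<^esub> (short_rel l `` {B}) = short_rel l `` {A * B}"
proof -
  have self: "A \<in> short_rel l `` {A}" "B \<in> short_rel l `` {B}"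
    using assms equiv_class_self[OF equiv_short_rel] by blast+
  have "short_rel l `` {A' * B'} = short_rel l `` {A * B}"
    if "A' \<in> short_rel l `` {A}" "B' \<in> short_rel l `` {B}" for A' B'
    using equiv_class_eq[OF equiv_short_rel short_rel_mult] that by blast
  then have "(\<Union>A'\<in>short_rel l `` {A}. \<Union>B'\<in>short_rel l `` {B}. short_rel l `` {A' * B'})
      = short_rel l `` {A * B}"
    using self by blast
  then show ?thesis
    by (simp only: class_group_def monoid.simps)
qed

lemma finite_monic_degree:
  "finite {f. f \<in> (monic_polys :: 'a::{field,finite} poly set) \<and> degree f = n}"
proof (rule finite_imageD)
  show "finite (coeffs ` {f. f \<in> (monic_polys :: 'a poly set) \<and> degree f = n})"
    by (rule finite_subset[OF _ finite_lists_length_le[of "UNIV :: 'a set" "Suc n"]])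
       (auto simp: coeffs_def)
  show "inj_on coeffs {f. f \<in> (monic_polys :: 'a poly set) \<and> degree f = n}"
    by (simp add: inj_on_def coeffs_eq_iff)
qed

end

theory Submission
  imports Defs
begin

text \<open>
  Let \<open>q = CARD('a)\<close>. Since the characteristic exceeds three, truncated exponential and
  logarithm identify the group of classes of level three with three copies of the additive group,
  and there is an additive character \<open>\<psi>\<close>, invariant under Frobenius, such that \<open>\<chi>\<close>
  of a monic polynomial is \<open>\<psi>\<close> of an explicit polynomial in its first three next-to-leading
  coefficients (lemma \<open>short_char_via_logarithm\<close>). The coefficients of the L-function in degree at
  least three vanish. The one in degree one is a cubic exponential sum, which after completing the cube
  becomes \<open>\<eta> * S\<close> with \<open>\<eta> ^ 5 = 1\<close> and \<open>S\<close> the sum of all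
  \<open>\<psi> (\<gamma> * x ^ 3 + \<alpha> * x)\<close>; the one in degree two is \<open>\<eta>\<^sup>2 * q\<close>. So the
  normalised polynomial is \<open>w\<^sup>2 + t * w + 1\<close> with \<open>w = \<eta> * z\<close> and
  \<open>t = S / sqrt q\<close>, and everything depends on the value of \<open>t\<close>.

  The cubic sum can be evaluated because \<open>6 = 5 + 1\<close>: substituting \<open>x = z\<^sup>2\<close>, and
  \<open>x = n * z\<^sup>2\<close> for a nonsquare \<open>n\<close>, covers the field twice and turns the cubic into
  quadratic forms \<open>\<gamma> * z ^ 6 + \<alpha> * z\<^sup>2\<close> over the prime field, so \<open>2 * S\<close> is a
  sum of two quadratic Gauss sums (lemma \<open>cubic_sum_eq_sextic_sums\<close>). If both forms are
  nondegenerate, each sum is \<open>sqrt q\<close> up to sign and \<open>t\<close> is \<open>0\<close>, \<open>1\<close> or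
  \<open>- 1\<close>. Otherwise one may rescale so that \<open>1\<close> lies in the radical. Then the two forms are
  \<open>\<kappa> * (z ^ 5 - z)\<^sup>2\<close> and \<open>\<kappa> * n * (n\<^sup>2 * z ^ 5 - z)\<^sup>2\<close> up to terms on which
  \<open>\<psi>\<close> is trivial, where \<open>\<kappa> = 2 * \<gamma>\<close>. The substitution in the second
  is bijective; that in the first is five to one onto the kernel of the trace. Both sums are therefore multiples of the Gauss sum of \<open>\<kappa>\<close>, and adding
  them yields \<open>t = \<theta> + \<theta> ^ 4\<close> up to sign for a fifth root of unity \<open>\<theta>\<close>
  (lemma \<open>cubic_sum_degenerate\<close>). In every case the roots \<open>w\<close> have order dividing
  \<open>60\<close>, hence so do the \<open>z\<close>.
\<close>

section \<open>Finite fields of characteristic five\<close>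

lemma of_nat_card_eq_0: "of_nat CARD('a) = (0 :: 'a::{field,finite})"
proof -
  have "(\<Sum>x\<in>UNIV. x) = (\<Sum>x\<in>UNIV. x + (1::'a))"
    by (rule sum.reindex_bij_witness[of _ "\<lambda>x. x + 1" "\<lambda>x. x - 1"]) auto
  then show ?thesis
    by (simp add: sum.distrib)
qed

lemma five_eq_0:
  assumes "CARD('a) = 5 ^ r"
  shows "(5 :: 'a::{field,finite}) = 0"
  using of_nat_card_eq_0[where 'a = 'a] by (simp add: assms)

lemma power_card_eq_self: "x ^ CARD('a) = (x :: 'a::{field,finite})"
proof (cases "x = 0")
  case False
  let ?U = "UNIV - {0 :: 'a}"
  have "(\<Prod>y\<in>?U. y) = (\<Prod>y\<in>?U. x * y)"
    by (rule prod.reindex_bij_witness[of _ "\<lambda>y. x * y" "\<lambda>y. y / x"]) (use False in auto)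
  also have "\<dots> = x ^ card ?U * (\<Prod>y\<in>?U. y)"
    by (simp add: prod.distrib)
  finally have "x ^ card ?U = 1"
    by simp
  moreover have "CARD('a) = Suc (card ?U)"
    by (simp add: card_Diff_singleton_if)
  ultimately show ?thesis
    by (simp only: power_Suc mult_1_right)
qed (simp add: power_0_left)

lemma frobenius_add:
  assumes "(5 :: 'a::field) = 0"
  shows "(x + y) ^ 5 = x ^ 5 + (y :: 'a) ^ 5"
proof -
  have "(x + y) ^ 5 = x ^ 5 + y ^ 5 + 5 * (x ^ 4 * y + 2 * x ^ 3 * y ^ 2 + 2 * x ^ 2 * y ^ 3 + x * y ^ 4)"
    by algebra
  then show ?thesis using assms by simp
qed

lemma frobenius_diff:
  assumes "(5 :: 'a::field) = 0"
  shows "(x - y) ^ 5 = x ^ 5 - (y :: 'a) ^ 5"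
  using frobenius_add[OF assms, of x "- y"] by simp

lemma frobenius_power_add:
  assumes "(5 :: 'a::field) = 0"
  shows "(x + y) ^ 5 ^ i = x ^ 5 ^ i + (y :: 'a) ^ 5 ^ i"
  by (induction i) (simp_all add: power_Suc2 power_mult frobenius_add[OF assms] del: power_Suc)

lemma bij_frobenius:
  assumes "(5 :: 'a::{field,finite}) = 0"
  shows "bij (\<lambda>x::'a. x ^ 5)"
proof -
  have "inj (\<lambda>x::'a. x ^ 5)"
    proof (rule injI)
    fix x y :: 'a assume "x ^ 5 = y ^ 5"
    then have "(x - y) ^ 5 = 0" by (simp add: frobenius_diff[OF assms])
    then show "x = y" by simp
  qed
  then show ?thesis
    by (simp add: finite_UNIV_inj_surj bij_def)
qed

lemma small_nonzero_five:
  assumes "(5 :: 'a::field) = 0"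
  shows "(2 :: 'a) \<noteq> 0" "(3 :: 'a) \<noteq> 0" "(4 :: 'a) \<noteq> 0"
proof -
  have "(2::'a) * 3 = 5 + 1" "(4::'a) * 4 = 5 * 3 + 1" by simp_all
  then have "(2::'a) * 3 = 1" "(4::'a) * 4 = 1" using assms by simp_all
  then show "(2 :: 'a) \<noteq> 0" "(3 :: 'a) \<noteq> 0" "(4 :: 'a) \<noteq> 0" by (metis mult_zero_left mult_zero_right zero_neq_one)+
qed

lemma fixed_by_frobenius:
  assumes "(5 :: 'a::field) = 0"
  shows "{c :: 'a. c ^ 5 = c} = {0, 1, 2, 3, 4}"
proof -
  have "c ^ 5 - c = c * (c - 1) * (c - 2) * (c - 3) * (c - 4) + 5 * (2 * c ^ 4 - 7 * c ^ 3 + 10 * c ^ 2 - 5 * c)"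
    for c :: 'a
    by algebra
  then have "c ^ 5 - c = c * (c - 1) * (c - 2) * (c - 3) * (c - 4)" for c :: 'a
    using assms by simp
  then have "c ^ 5 = c \<longleftrightarrow> c * (c - 1) * (c - 2) * (c - 3) * (c - 4) = 0" for c :: 'a
    by (metis eq_iff_diff_eq_0)
  then show ?thesis by auto
qed

lemma distinct_prime_field_five:
  assumes "(5 :: 'a::field) = 0"
  shows "distinct [0, 1, 2, 3, 4 :: 'a]"
proof -
  have ne: "x \<noteq> y" if "y - x \<noteq> 0" for x y :: 'a
    using that by auto
  have "(1::'a) \<noteq> 2" "(1::'a) \<noteq> 3" "(1::'a) \<noteq> 4" "(2::'a) \<noteq> 3" "(2::'a) \<noteq> 4" "(3::'a) \<noteq> 4"
    by (rule ne, simp add: small_nonzero_five[OF assms])+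
  then show ?thesis
    using small_nonzero_five[OF assms] by (simp add: eq_commute)
qed

section \<open>Squares\<close>

lemma square_fibre:
  assumes "v \<noteq> 0"
  shows "{z \<in> UNIV - {0}. z\<^sup>2 = v\<^sup>2} = {v, - v :: 'a::field}"
  using assms by (auto simp: power2_eq_iff)

lemma sum_squares_nonzero:
  fixes g :: "'a::{field,finite} \<Rightarrow> 'b::{semiring_1}"
  assumes "(2 :: 'a) \<noteq> 0"
  shows "(\<Sum>z\<in>UNIV - {0}. g (z\<^sup>2)) = 2 * (\<Sum>x\<in>(\<lambda>z. z\<^sup>2) ` (UNIV - {0}). g x)"
proof -
  have "v \<noteq> - v" if "v \<noteq> 0" for v :: 'a
  proof
    assume "v = - v"
    then have "2 * v = 0" by (metis add.right_inverse mult_2)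
    with that assms show False by simp
  qed
  then have card: "card {z \<in> UNIV - {0}. z\<^sup>2 = v\<^sup>2} = 2" if "v \<noteq> 0" for v :: 'a
    unfolding square_fibre[OF that] using that by simp
  have "(\<Sum>z\<in>UNIV - {0}. g (z\<^sup>2)) =
      (\<Sum>x\<in>(\<lambda>z. z\<^sup>2) ` (UNIV - {0}). \<Sum>z\<in>{z \<in> UNIV - {0}. z\<^sup>2 = x}. g (z\<^sup>2))"
    by (rule sum.image_gen) simp
  also have "\<dots> = (\<Sum>x\<in>(\<lambda>z. z\<^sup>2) ` (UNIV - {0}). 2 * g x)"
  proof (rule sum.cong[OF refl])
    fix x assume "x \<in> (\<lambda>z. z\<^sup>2) ` (UNIV - {0 :: 'a})"
    then have "card {z \<in> UNIV - {0}. z\<^sup>2 = x} = 2" using card by auto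
    then show "(\<Sum>z\<in>{z \<in> UNIV - {0}. z\<^sup>2 = x}. g (z\<^sup>2)) = 2 * g x" by simp
  qed
  finally show ?thesis by (simp add: sum_distrib_left)
qed

lemma nonsquare_exists:
  assumes "(2 :: 'a::{field,finite}) \<noteq> 0"
  obtains n :: "'a::{field,finite}" where "\<And>y. n \<noteq> y\<^sup>2"
proof -
  have "\<not> inj (\<lambda>z::'a. z\<^sup>2)"
  proof
    assume "inj (\<lambda>z::'a. z\<^sup>2)"
    then have "(1::'a) = -1" by (rule injD) simp
    then have "(2::'a) = 0" by (metis add.right_inverse one_add_one)
    with assms show False ..
  qed
  then have "\<not> surj (\<lambda>z::'a. z\<^sup>2)"
    using finite_UNIV_surj_inj[of "\<lambda>z::'a. z\<^sup>2"] by auto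
  then show ?thesis using that by (auto simp: surj_def)
qed

text \<open>Every nonzero element is a square or \<open>n\<close> times a square, in exactly two ways.\<close>

lemma sum_over_squares_and_nonsquares:
  fixes g :: "'a::{field,finite} \<Rightarrow> 'b::{comm_ring_1}"
  assumes "(2 :: 'a) \<noteq> 0" and n: "\<And>y. n \<noteq> y\<^sup>2"
  shows "(\<Sum>z\<in>UNIV. g (z\<^sup>2)) + (\<Sum>z\<in>UNIV. g (n * z\<^sup>2)) = 2 * (\<Sum>x\<in>UNIV. g x)"
proof -
  let ?U = "UNIV - {0 :: 'a}"
  define S where "S = (\<lambda>z. z\<^sup>2) ` ?U"
  define N where "N = (\<lambda>x. n * x) ` S"
  have n0: "n \<noteq> 0" using n[of 0] by auto
  then have inj: "inj_on (\<lambda>x. n * x) S" by (auto intro: inj_onI)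
  have disj: "S \<inter> N = {}"
  proof (rule ccontr)
    assume "S \<inter> N \<noteq> {}"
    then obtain y z where "z \<noteq> 0" "y\<^sup>2 = n * z\<^sup>2" by (auto simp: S_def N_def)
    then have "n = (y / z)\<^sup>2" by (simp add: power_divide)
    with n show False by blast
  qed
  have "card ?U = 2 * card S"
    using sum_squares_nonzero[OF assms(1), of "\<lambda>_. 1 :: nat"] by (simp add: S_def)
  also have "\<dots> = card (S \<union> N)"
    using card_image[OF inj] disj by (subst card_Un_disjoint) (auto simp: S_def N_def)
  finally have "S \<union> N = ?U"
    by (intro card_subset_eq) (use n0 in \<open>auto simp: S_def N_def\<close>)
  then have all: "(\<Sum>x\<in>?U. g x) = (\<Sum>x\<in>S. g x) + (\<Sum>x\<in>S. g (n * x))"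
    using disj sum.union_disjoint[of S N g] sum.reindex[OF inj, of g] by (simp add: N_def)
  have split: "(\<Sum>z\<in>UNIV. h z) = h 0 + (\<Sum>z\<in>?U. h z)" for h :: "'a \<Rightarrow> 'b"
    by (rule sum.remove) simp_all
  show ?thesis
    using sum_squares_nonzero[OF assms(1), of g] sum_squares_nonzero[OF assms(1), of "\<lambda>x. g (n * x)"]
    by (simp add: split all S_def[symmetric] algebra_simps)
qed

section \<open>Additive characters\<close>

text \<open>An additive character of a finite field, as a function into the complex numbers.\<close>

locale additive_character =
  fixes \<psi> :: "'a::{field,finite} \<Rightarrow> complex"
  assumes zero [simp]: "\<psi> 0 = 1"
    and add: "\<psi> (x + y) = \<psi> x * \<psi> y"
begin

lemma sum_eq_0:
  assumes "\<psi> c \<noteq> 1"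
  shows "(\<Sum>x\<in>UNIV. \<psi> x) = 0"
proof -
  have "(\<Sum>x\<in>UNIV. \<psi> x) = (\<Sum>x\<in>UNIV. \<psi> (c + x))"
    by (rule sum.reindex_bij_witness[of _ "\<lambda>x. c + x" "\<lambda>x. x - c"]) auto
  also have "\<dots> = \<psi> c * (\<Sum>x\<in>UNIV. \<psi> x)"
    by (simp add: add sum_distrib_left)
  finally show ?thesis
    using assms by simp
qed

lemma scaled: "additive_character (\<lambda>x. \<psi> (c * x))"
  by unfold_locales (simp_all add: distrib_left add)

lemma power: "\<psi> x ^ n = \<psi> (of_nat n * x)"
  by (induction n) (simp_all add: distrib_right add)

lemma fifth_power:
  assumes "(5 :: 'a) = 0"
  shows "\<psi> x ^ 5 = 1"
  using power[of x 5] assms by simp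

lemma cnj:
  assumes "(5 :: 'a) = 0"
  shows "cnj (\<psi> x) = \<psi> (- x)"
proof -
  have "norm (\<psi> x) ^ 5 = 1"
    by (simp add: fifth_power[OF assms] flip: norm_power)
  then have "norm (\<psi> x) = 1"
    using power_inject_base[of "norm (\<psi> x)" 4 1] by simp
  then have "\<psi> x * cnj (\<psi> x) = 1"
    by (simp add: complex_norm_square [symmetric])
  moreover have "\<psi> x * \<psi> (- x) = 1"
    by (simp flip: add)
  ultimately show ?thesis
    by (metis mult_cancel_left mult_zero_left zero_neq_one)
qed

end

text \<open>A nontrivial additive character in characteristic five that takes the same value on \<open>x\<close>
  and on \<open>x ^ 5\<close>.\<close>

locale frobenius_character = additive_character \<psi> for \<psi> :: "'a::{field,finite} \<Rightarrow> complex" +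
  assumes five [simp]: "(5 :: 'a) = 0"
    and nontrivial: "\<exists>x. \<psi> x \<noteq> 1"
    and frobenius: "\<psi> (x ^ 5) = \<psi> x"
begin

lemma sum_linear: "(\<Sum>x\<in>UNIV. \<psi> (c * x)) = (if c = 0 then of_nat CARD('a) else 0)"
proof (cases "c = 0")
  case False
  interpret scaled: additive_character "\<lambda>x. \<psi> (c * x)"
    by (rule scaled)
  obtain x where "\<psi> x \<noteq> 1"
    using nontrivial by blast
  then show ?thesis
    using scaled.sum_eq_0[of "x / c"] False by simp
qed simp

text \<open>If \<open>\<phi>\<close> were none of the characters \<open>x \<mapsto> \<psi> (c * x)\<close>, it would be orthogonal
  to all of them, and summing the orthogonality relations over \<open>c\<close> would give \<open>\<phi> 0 = 0\<close>.\<close>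

lemma additive_character_scaled:
  assumes "additive_character \<phi>"
  obtains c where "\<And>x. \<phi> x = \<psi> (c * x)"
proof (rule ccontr)
  interpret \<phi>: additive_character \<phi> by fact
  assume "\<not> thesis"
  then have *: "\<exists>x. \<phi> x \<noteq> \<psi> (c * x)" for c
    using that by blast
  have orth: "(\<Sum>x\<in>UNIV. \<phi> x * \<psi> (c * x)) = 0" for c
  proof -
    interpret prod: additive_character "\<lambda>x. \<phi> x * \<psi> (c * x)"
      by unfold_locales (simp_all add: distrib_left add \<phi>.add)
    obtain x where "\<phi> x \<noteq> \<psi> (- c * x)"
      using * by blast
    moreover have "\<psi> (- c * x) * \<psi> (c * x) = 1"
      by (simp flip: add)
    ultimately have "\<phi> x * \<psi> (c * x) \<noteq> 1"
      by (metis mult_cancel_right mult_zero_right zero_neq_one)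
    then show ?thesis
      by (rule prod.sum_eq_0)
  qed
  have "0 = (\<Sum>c\<in>UNIV. \<Sum>x\<in>UNIV. \<phi> x * \<psi> (c * x))"
    by (simp add: orth)
  also have "\<dots> = (\<Sum>x\<in>UNIV. \<Sum>c\<in>UNIV. \<phi> x * \<psi> (x * c))"
    by (subst sum.swap) (simp add: mult.commute)
  also have "\<dots> = (\<Sum>x\<in>UNIV. if x = (0::'a) then of_nat CARD('a) else 0)"
  proof (intro sum.cong refl)
    fix x
    show "(\<Sum>c\<in>UNIV. \<phi> x * \<psi> (x * c)) = (if x = 0 then of_nat CARD('a) else 0)"
      using sum_linear[of x] by (simp add: sum_distrib_left[symmetric])
  qed
  finally show False
    by simp
qed

end

text \<open>The trace is a nonzero polynomial of degree less than the number of elements.\<close>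

lemma trace_not_zero:
  assumes "CARD('a) = 5 ^ r" and "r \<ge> 1"
  shows "\<exists>x :: 'a::{field,finite}. (\<Sum>i<r. x ^ 5 ^ i) \<noteq> 0"
proof (rule ccontr)
  define p where "p = (\<Sum>i<r. monom (1::'a) (5 ^ i))"
  have poly: "poly p x = (\<Sum>i<r. x ^ 5 ^ i)" for x
    by (simp add: p_def poly_sum poly_monom)
  assume "\<nexists>x :: 'a. (\<Sum>i<r. x ^ 5 ^ i) \<noteq> 0"
  then have roots: "{x. poly p x = 0} = UNIV"
    by (simp add: poly)
  have "coeff p 1 = (\<Sum>i<r. if i = 0 then 1 else 0)"
    unfolding p_def coeff_sum by (intro sum.cong) (auto simp: coeff_monom)
  also have "\<dots> = 1"
    using assms by simp
  finally have "p \<noteq> 0"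
    by auto
  then have "5 ^ r \<le> degree p"
    using card_poly_roots_bound[of p] roots assms by simp
  also have "degree p \<le> 5 ^ (r - 1)"
    unfolding p_def by (intro degree_sum_le) (auto intro!: order.trans[OF degree_monom_le] power_increasing)
  also have "\<dots> < (5 :: nat) ^ r"
    using assms by (intro power_strict_increasing) auto
  finally show False
    by simp
qed

text \<open>Composing with the trace makes a character invariant under Frobenius.\<close>

lemma frobenius_character_exists:
  fixes \<phi> :: "'a::{field,finite} \<Rightarrow> complex"
  assumes "CARD('a) = 5 ^ r" and "r \<ge> 1" and "additive_character \<phi>" and "\<phi> y \<noteq> 1"
  obtains \<psi> :: "'a \<Rightarrow> complex" where "frobenius_character \<psi>"
proof -
  interpret \<phi>: additive_character \<phi> by fact
  note five = five_eq_0[OF assms(1)]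
  define Tr where "Tr x = (\<Sum>i<r. x ^ 5 ^ i)" for x :: 'a
  obtain x0 where x0: "Tr x0 \<noteq> 0"
    using trace_not_zero[OF assms(1,2)] by (auto simp: Tr_def)
  define \<psi> where "\<psi> x = \<phi> (y / Tr x0 * Tr x)" for x
  have Tr_add: "Tr (x + z) = Tr x + Tr z" for x z
    by (simp add: Tr_def frobenius_power_add[OF five] sum.distrib)
  have Tr_frob: "Tr (x ^ 5) = Tr x" for x
  proof -
    have "Tr (x ^ 5) + x = (\<Sum>i<r. x ^ 5 ^ Suc i) + x ^ 5 ^ 0"
      by (simp add: Tr_def flip: power_mult)
    also have "\<dots> = (\<Sum>i<Suc r. x ^ 5 ^ i)"
      by (subst sum.lessThan_Suc_shift) (simp add: add.commute)
    also have "\<dots> = Tr x + x"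
      using power_card_eq_self[of x] by (simp add: Tr_def assms(1))
    finally show ?thesis by simp
  qed
  have "Tr 0 = 0"
    using Tr_add[of 0 0] by (metis add.right_neutral add_left_cancel)
  have "frobenius_character \<psi>"
  proof
    show "\<psi> 0 = 1" by (simp add: \<psi>_def \<open>Tr 0 = 0\<close>)
    show "\<psi> (x + z) = \<psi> x * \<psi> z" for x z
      by (simp add: \<psi>_def Tr_add distrib_left \<phi>.add)
    show "(5::'a) = 0" by (rule five)
    show "\<exists>x. \<psi> x \<noteq> 1"
      using x0 assms(4) by (intro exI[of _ x0]) (simp add: \<psi>_def)
    show "\<psi> (x ^ 5) = \<psi> x" for x
      by (simp add: \<psi>_def Tr_frob)
  qed
  then show ?thesis by (rule that)
qed

section \<open>Quadratic forms and cubic exponential sums\<close>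

context frobenius_character
begin

lemma eq_by_five: "x = y" if "x = y + 5 * z" for x y z :: 'a
  using that by simp

text \<open>In characteristic five \<open>z \<mapsto> \<psi> (\<gamma> * z ^ 6 + \<alpha> * z\<^sup>2)\<close> is a quadratic form
  followed by a character, because \<open>z ^ 6 = z ^ 5 * z\<close>. The nonzero elements of its radical are
  the zeros of the polynomial in the assumption.\<close>

lemma sextic_sum_square:
  fixes \<alpha> \<gamma> :: 'a
  assumes nondeg: "\<And>z. z \<noteq> 0 \<Longrightarrow> \<gamma> ^ 5 * z ^ 24 + 2 * \<alpha> ^ 5 * z ^ 4 + \<gamma> \<noteq> 0"
  shows "(\<Sum>z\<in>UNIV. \<psi> (\<gamma> * z ^ 6 + \<alpha> * z\<^sup>2))\<^sup>2 = of_nat CARD('a)"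
proof -
  define f where "f z = \<gamma> * z ^ 6 + \<alpha> * z\<^sup>2" for z
  define M where "M z = \<gamma> ^ 5 * z ^ 25 + 2 * \<alpha> ^ 5 * z ^ 5 + \<gamma> * z" for z
  define S where "S = (\<Sum>z\<in>UNIV. \<psi> (f z))"
  \<comment> \<open>\<open>S\<close> is real, because \<open>2\<^sup>2 = 2 ^ 6 = - 1\<close>\<close>
  have "cnj S = (\<Sum>z\<in>UNIV. \<psi> (- f z))"
    by (simp add: S_def cnj)
  also have "\<dots> = (\<Sum>z\<in>UNIV. \<psi> (f (2 * z)))"
  proof -
    have "f (2 * z) = - f z + 5 * (13 * \<gamma> * z ^ 6 + \<alpha> * z\<^sup>2)" for z
      unfolding f_def by algebra
    then show ?thesis by simp
  qed
  also have "\<dots> = S"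
    unfolding S_def
    by (rule sum.reindex_bij_witness[of _ "\<lambda>z. z / 2" "\<lambda>z. 2 * z"])
       (use small_nonzero_five[OF five] in auto)
  finally have real: "cnj S = S" .
  have polar: "f (z + w) - f w = f z + (\<gamma> * z ^ 5 * w + 2 * \<alpha> * z * w + \<gamma> * z * w ^ 5)" for z w
  proof -
    have "(z + w) ^ 6 = (z ^ 5 + w ^ 5) * (z + w)"
      using frobenius_add[OF five, of z w] by (simp add: power_Suc2[of _ 5, simplified])
    then have "f (z + w) - f w = \<gamma> * ((z ^ 5 + w ^ 5) * (z + w)) + \<alpha> * (z + w)\<^sup>2 - (\<gamma> * w ^ 6 + \<alpha> * w\<^sup>2)"
      by (simp add: f_def)
    also have "\<dots> = \<gamma> * z ^ 6 + \<alpha> * z\<^sup>2 + (\<gamma> * z ^ 5 * w + 2 * \<alpha> * z * w + \<gamma> * z * w ^ 5)"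
      by algebra
    finally show ?thesis by (simp add: f_def)
  qed
  \<comment> \<open>Frobenius invariance makes the polar form linear in \<open>w ^ 5\<close>\<close>
  have twist: "\<psi> (\<gamma> * z ^ 5 * w + 2 * \<alpha> * z * w + \<gamma> * z * w ^ 5) = \<psi> (M z * w ^ 5)" for z w
  proof -
    have "(2 * \<alpha> * z * w) ^ 5 = 2 * \<alpha> ^ 5 * z ^ 5 * w ^ 5 + 5 * (6 * (\<alpha> * z * w) ^ 5)"
      by algebra
    then have 1: "\<psi> (2 * \<alpha> * z * w) = \<psi> (2 * \<alpha> ^ 5 * z ^ 5 * w ^ 5)"
      using frobenius[of "2 * \<alpha> * z * w"] by simp
    have "(\<gamma> * z ^ 5 * w) ^ 5 = \<gamma> ^ 5 * z ^ 25 * w ^ 5"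
      by algebra
    then have 2: "\<psi> (\<gamma> * z ^ 5 * w) = \<psi> (\<gamma> ^ 5 * z ^ 25 * w ^ 5)"
      using frobenius[of "\<gamma> * z ^ 5 * w"] by simp
    show ?thesis
      by (simp add: M_def add 1 2 distrib_right)
  qed
  have M_eq_0: "M z = 0 \<longleftrightarrow> z = 0" for z
  proof -
    have "M z = z * (\<gamma> ^ 5 * z ^ 24 + 2 * \<alpha> ^ 5 * z ^ 4 + \<gamma>)"
      unfolding M_def by algebra
    with nondeg[of z] show ?thesis by auto
  qed
  have inner: "(\<Sum>w\<in>UNIV. \<psi> (M z * w ^ 5)) = (if z = 0 then of_nat CARD('a) else 0)" for z
  proof -
    have "(\<Sum>w\<in>UNIV. \<psi> (M z * w ^ 5)) = (\<Sum>w\<in>UNIV. \<psi> (M z * w))"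
      using sum.reindex_bij_betw[OF bij_frobenius[OF five], of "\<lambda>w. \<psi> (M z * w)"] by simp
    then show ?thesis by (simp add: sum_linear M_eq_0)
  qed
  have "S\<^sup>2 = S * cnj S"
    by (simp add: real power2_eq_square)
  also have "\<dots> = (\<Sum>w\<in>UNIV. \<Sum>z\<in>UNIV. \<psi> (f z - f w))"
    by (subst sum.swap) (simp add: S_def cnj sum_product flip: add)
  also have "\<dots> = (\<Sum>w\<in>UNIV. \<Sum>z\<in>UNIV. \<psi> (f (z + w) - f w))"
  proof (rule sum.cong[OF refl])
    fix w :: 'a
    show "(\<Sum>z\<in>UNIV. \<psi> (f z - f w)) = (\<Sum>z\<in>UNIV. \<psi> (f (z + w) - f w))"
      by (rule sum.reindex_bij_witness[of _ "\<lambda>z. z + w" "\<lambda>z. z - w"]) auto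
  qed
  also have "\<dots> = (\<Sum>z\<in>UNIV. \<psi> (f z) * (\<Sum>w\<in>UNIV. \<psi> (M z * w ^ 5)))"
    by (subst sum.swap) (simp add: polar twist add[of "f _"] sum_distrib_left)
  also have "\<dots> = (\<Sum>z\<in>UNIV. if z = (0::'a) then of_nat CARD('a) else 0)"
    by (intro sum.cong refl) (simp add: inner f_def)
  also have "\<dots> = of_nat CARD('a)"
    by simp
  finally show ?thesis by (simp add: S_def f_def)
qed

text \<open>The quadratic Gauss sum attached to \<open>\<psi>\<close>, summed over all arguments rather than
  written with the quadratic residue symbol.\<close>

definition gauss_sum :: "'a \<Rightarrow> complex" where
  "gauss_sum \<kappa> = (\<Sum>y\<in>UNIV. \<psi> (\<kappa> * y\<^sup>2))"

lemma gauss_sum_square: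
  assumes "\<kappa> \<noteq> 0"
  shows "(gauss_sum \<kappa>)\<^sup>2 = of_nat CARD('a)"
  using sextic_sum_square[of 0 \<kappa>] assms small_nonzero_five[OF five] by (simp add: gauss_sum_def)

lemma gauss_sum_nonsquare:
  assumes "\<kappa> \<noteq> 0" and "\<And>y. n \<noteq> y\<^sup>2"
  shows "gauss_sum (\<kappa> * n) = - gauss_sum \<kappa>"
proof -
  have "gauss_sum \<kappa> + gauss_sum (\<kappa> * n) = 2 * (\<Sum>x\<in>UNIV. \<psi> (\<kappa> * x))"
    using sum_over_squares_and_nonsquares[OF _ assms(2), of "\<lambda>x. \<psi> (\<kappa> * x)"] small_nonzero_five[OF five]
    by (simp add: gauss_sum_def mult.assoc)
  then show ?thesis
    using assms(1) by (simp add: sum_linear add_eq_0_iff)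
qed

lemma gauss_sum_linear_term:
  assumes "\<kappa> \<noteq> 0"
  shows "(\<Sum>y\<in>UNIV. \<psi> (\<kappa> * y\<^sup>2 + c * y)) = \<psi> (c\<^sup>2 / \<kappa>) * gauss_sum \<kappa>"
proof -
  \<comment> \<open>completing the square, with \<open>- 1 / 4 = 1\<close> and \<open>1 / 2 = 3\<close>\<close>
  have "\<kappa> * y\<^sup>2 + c * y = c\<^sup>2 / \<kappa> + \<kappa> * (y + 3 * c / \<kappa>)\<^sup>2" for y
  proof (rule eq_by_five)
    show "\<kappa> * y\<^sup>2 + c * y = c\<^sup>2 / \<kappa> + \<kappa> * (y + 3 * c / \<kappa>)\<^sup>2 + 5 * (- c * y - 2 * c\<^sup>2 / \<kappa>)"
      using assms by (simp add: field_simps power2_eq_square del: five)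
  qed
  then have "(\<Sum>y\<in>UNIV. \<psi> (\<kappa> * y\<^sup>2 + c * y)) = \<psi> (c\<^sup>2 / \<kappa>) * (\<Sum>y\<in>UNIV. \<psi> (\<kappa> * (y + 3 * c / \<kappa>)\<^sup>2))"
    by (simp add: add sum_distrib_left)
  also have "(\<Sum>y\<in>UNIV. \<psi> (\<kappa> * (y + 3 * c / \<kappa>)\<^sup>2)) = gauss_sum \<kappa>"
    unfolding gauss_sum_def
    by (rule sum.reindex_bij_witness[of _ "\<lambda>y. y - 3 * c / \<kappa>" "\<lambda>y. y + 3 * c / \<kappa>"]) auto
  finally show ?thesis .
qed

text \<open>The elements \<open>z ^ 5 - z\<close> form the kernel of the trace, each arising five times, and
  five times the indicator function of this kernel at \<open>y\<close> is the sum of \<open>\<psi> (c * y)\<close> over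
  the prime field.\<close>

lemma sum_artin_schreier:
  "(\<Sum>z\<in>UNIV. g (z ^ 5 - z)) = (\<Sum>c\<in>{0, 1, 2, 3, 4}. \<Sum>y\<in>UNIV. \<psi> (c * y) * g y)"
  for g :: "'a \<Rightarrow> complex"
proof -
  let ?q = "of_nat CARD('a) :: complex"
  have detect: "(\<Sum>c\<in>UNIV. \<psi> (c * y - c * (z ^ 5 - z))) = (if y = z ^ 5 - z then ?q else 0)" for y z
    using sum_linear[of "y - (z ^ 5 - z)"] by (simp add: algebra_simps)
  have collect: "(\<Sum>z\<in>UNIV. \<psi> (c * y - c * (z ^ 5 - z))) = (if c ^ 5 = c then \<psi> (c * y) * ?q else 0)" for c y
  proof -
    have "\<psi> (c * y - c * (z ^ 5 - z)) = \<psi> (c * y) * \<psi> ((c ^ 5 - c) * z ^ 5)" for z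
    proof -
      have "\<psi> (c * y - c * (z ^ 5 - z)) = \<psi> (c * y) * \<psi> (- (c * z ^ 5)) * \<psi> (c * z)"
        by (simp add: algebra_simps flip: add)
      also have "\<psi> (c * z) = \<psi> (c ^ 5 * z ^ 5)"
        using frobenius[of "c * z"] by (simp add: power_mult_distrib)
      finally show ?thesis by (simp add: algebra_simps flip: add)
    qed
    moreover have "(\<Sum>z\<in>UNIV. \<psi> ((c ^ 5 - c) * z ^ 5)) = (\<Sum>z\<in>UNIV. \<psi> ((c ^ 5 - c) * z))"
      using sum.reindex_bij_betw[OF bij_frobenius[OF five], of "\<lambda>z. \<psi> ((c ^ 5 - c) * z)"] by simp
    ultimately show ?thesis
      by (simp add: sum_linear flip: sum_distrib_left)
  qed
  have "?q * (\<Sum>z\<in>UNIV. g (z ^ 5 - z)) =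
      (\<Sum>z\<in>UNIV. \<Sum>y\<in>UNIV. \<Sum>c\<in>UNIV. \<psi> (c * y - c * (z ^ 5 - z)) * g y)"
    by (simp add: detect sum_distrib_left if_distrib[of "\<lambda>x. x * _"] sum.delta flip: sum_distrib_right cong: if_cong)
  also have "\<dots> = (\<Sum>c\<in>UNIV. \<Sum>y\<in>UNIV. \<Sum>z\<in>UNIV. \<psi> (c * y - c * (z ^ 5 - z)) * g y)"
  proof -
    have "(\<Sum>z\<in>UNIV. \<Sum>y\<in>UNIV. \<Sum>c\<in>UNIV. h z y c) = (\<Sum>c\<in>UNIV. \<Sum>y\<in>UNIV. \<Sum>z\<in>UNIV. h z y c)"
      for h :: "'a \<Rightarrow> 'a \<Rightarrow> 'a \<Rightarrow> complex"
    proof -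
      have "(\<Sum>z\<in>UNIV. \<Sum>y\<in>UNIV. \<Sum>c\<in>UNIV. h z y c) = (\<Sum>z\<in>UNIV. \<Sum>c\<in>UNIV. \<Sum>y\<in>UNIV. h z y c)"
        by (intro sum.cong refl sum.swap)
      also have "\<dots> = (\<Sum>c\<in>UNIV. \<Sum>z\<in>UNIV. \<Sum>y\<in>UNIV. h z y c)"
        by (rule sum.swap)
      also have "\<dots> = (\<Sum>c\<in>UNIV. \<Sum>y\<in>UNIV. \<Sum>z\<in>UNIV. h z y c)"
        by (intro sum.cong refl sum.swap)
      finally show ?thesis .
    qed
    then show ?thesis .
  qed
  also have "\<dots> = (\<Sum>c\<in>UNIV. if c ^ 5 = c then ?q * (\<Sum>y\<in>UNIV. \<psi> (c * y) * g y) else 0)"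
  proof (intro sum.cong refl)
    fix c
    have "(\<Sum>y\<in>UNIV. \<Sum>z\<in>UNIV. \<psi> (c * y - c * (z ^ 5 - z)) * g y) =
        (\<Sum>y\<in>UNIV. (if c ^ 5 = c then \<psi> (c * y) * ?q else 0) * g y)"
      by (simp only: collect flip: sum_distrib_right)
    then show "(\<Sum>y\<in>UNIV. \<Sum>z\<in>UNIV. \<psi> (c * y - c * (z ^ 5 - z)) * g y) =
        (if c ^ 5 = c then ?q * (\<Sum>y\<in>UNIV. \<psi> (c * y) * g y) else 0)"
      by (simp add: sum_distrib_left mult_ac)
  qed
  also have "\<dots> = ?q * (\<Sum>c\<in>{c. c ^ 5 = c}. \<Sum>y\<in>UNIV. \<psi> (c * y) * g y)"
    by (simp add: sum_distrib_left flip: sum.inter_filter)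
  finally show ?thesis
    by (simp add: fixed_by_frobenius[OF five])
qed

text \<open>The squares of the elements of the prime field are \<open>0\<close> once, \<open>1\<close> twice and
  \<open>4\<close> twice.\<close>

lemma sum_square_artin_schreier:
  assumes "\<kappa> \<noteq> 0"
  shows "(\<Sum>z\<in>UNIV. \<psi> (\<kappa> * (z ^ 5 - z)\<^sup>2)) =
    (1 + 2 * \<psi> (1 / \<kappa>) + 2 * \<psi> (1 / \<kappa>) ^ 4) * gauss_sum \<kappa>"
proof -
  have inner: "(\<Sum>y\<in>UNIV. \<psi> (c * y) * \<psi> (\<kappa> * y\<^sup>2)) = \<psi> (c\<^sup>2 / \<kappa>) * gauss_sum \<kappa>" for c
    using gauss_sum_linear_term[OF assms, of c] by (simp add: add.commute flip: add)
  have squares: "(9::'a) = 4" "(16::'a) = 1"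
    by (rule eq_by_five[of _ _ 1], simp del: five, rule eq_by_five[of _ _ 3], simp del: five)
  have "\<psi> (4 / \<kappa>) = \<psi> (1 / \<kappa>) ^ 4"
    by (simp add: power)
  then show ?thesis
    using distinct_prime_field_five[OF five]
    by (simp add: sum_artin_schreier[of "\<lambda>y. \<psi> (\<kappa> * y\<^sup>2)"] inner squares algebra_simps)
qed

text \<open>Both \<open>x = z\<^sup>2\<close> and \<open>x = n * z\<^sup>2\<close> turn the cubic into a quadratic form.\<close>

lemma cubic_sum_eq_sextic_sums:
  assumes "\<And>y. n \<noteq> y\<^sup>2"
  shows "(\<Sum>z\<in>UNIV. \<psi> (\<gamma> * z ^ 6 + \<alpha> * z\<^sup>2)) + (\<Sum>z\<in>UNIV. \<psi> (\<gamma> * n ^ 3 * z ^ 6 + \<alpha> * n * z\<^sup>2)) =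
    2 * (\<Sum>x\<in>UNIV. \<psi> (\<gamma> * x ^ 3 + \<alpha> * x))"
proof -
  have "(z\<^sup>2) ^ 3 = z ^ 6" for z :: 'a
    by (simp flip: power_mult)
  then show ?thesis
    using sum_over_squares_and_nonsquares[OF _ assms, of "\<lambda>x. \<psi> (\<gamma> * x ^ 3 + \<alpha> * x)"]
      small_nonzero_five[OF five]
    by (simp add: power_mult_distrib mult.assoc)
qed

text \<open>A nonzero \<open>d\<close> with \<open>n\<^sup>2 * d ^ 5 = d\<close> would make \<open>n * d\<^sup>2\<close> equal to
  \<open>1\<close> or to \<open>- 1 = 2\<^sup>2\<close>, and so \<open>n\<close> a square.\<close>

lemma bij_nonsquare_artin_schreier:
  fixes n :: 'a
  assumes "\<And>y. n \<noteq> y\<^sup>2"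
  shows "bij (\<lambda>z. n\<^sup>2 * z ^ 5 - z)"
proof -
  have "inj (\<lambda>z. n\<^sup>2 * z ^ 5 - z)"
  proof (rule injI, rule ccontr)
    fix z w :: 'a assume eq: "n\<^sup>2 * z ^ 5 - z = n\<^sup>2 * w ^ 5 - w" and "z \<noteq> w"
    define d where "d = z - w"
    have "d \<noteq> 0" using \<open>z \<noteq> w\<close> by (simp add: d_def)
    have "n\<^sup>2 * d ^ 5 = d"
      using eq unfolding d_def frobenius_diff[OF five] by (simp add: algebra_simps)
    moreover have "d * ((n * d\<^sup>2 - 1) * (n * d\<^sup>2 + 1)) = n\<^sup>2 * d ^ 5 - d"
      by algebra
    ultimately have "d * ((n * d\<^sup>2 - 1) * (n * d\<^sup>2 + 1)) = 0"
      by simp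
    then have "n * d\<^sup>2 = 1 \<or> n * d\<^sup>2 = - 1"
      using \<open>d \<noteq> 0\<close> by (auto simp: add_eq_0_iff2)
    moreover have "- 1 = (2::'a)\<^sup>2"
      by (rule eq_by_five[of _ _ "- 1"]) (simp del: five)
    ultimately have "n = (1 / d)\<^sup>2 \<or> n = (2 / d)\<^sup>2"
      using \<open>d \<noteq> 0\<close> by (auto simp: field_simps power_divide)
    with assms show False by blast
  qed
  then show ?thesis
    by (simp add: finite_UNIV_inj_surj bij_def)
qed

text \<open>The assumption says that \<open>1\<close> lies in the radical of
  \<open>\<gamma> * z ^ 6 + \<alpha> * z\<^sup>2\<close>. It determines \<open>\<alpha>\<close> in terms of the fifth root
  \<open>\<delta>\<close> of \<open>\<gamma>\<close>, and both quadratic forms become squares. The Gauss sum of a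
  nonsquare multiple has the opposite sign, so the summand \<open>1\<close> in lemma
  \<open>sum_square_artin_schreier\<close> cancels.\<close>

lemma cubic_sum_degenerate:
  assumes "\<gamma> \<noteq> 0" and root: "\<gamma> ^ 5 + 2 * \<alpha> ^ 5 + \<gamma> = 0"
  shows "(\<Sum>x\<in>UNIV. \<psi> (\<gamma> * x ^ 3 + \<alpha> * x)) =
    gauss_sum (2 * \<gamma>) * (\<psi> (1 / (2 * \<gamma>)) + \<psi> (1 / (2 * \<gamma>)) ^ 4)"
proof -
  have "2 \<noteq> (0::'a)" using small_nonzero_five[OF five] by simp
  then have \<kappa>: "2 * \<gamma> \<noteq> 0" using assms by simp
  obtain n :: 'a where n: "\<And>y. n \<noteq> y\<^sup>2"
    using nonsquare_exists[OF \<open>2 \<noteq> (0::'a)\<close>] by blast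
  obtain \<delta> where \<delta>: "\<gamma> = \<delta> ^ 5"
    using bij_is_surj[OF bij_frobenius[OF five]] by (auto simp: surj_def)
  have "(\<alpha> - 2 * (\<gamma> + \<delta>)) ^ 5 = \<alpha> ^ 5 - 32 * (\<gamma> ^ 5 + \<gamma>)"
    using \<delta> by (simp add: frobenius_diff[OF five] frobenius_add[OF five] power_mult_distrib)
  also have "\<dots> = 3 * (\<gamma> ^ 5 + 2 * \<alpha> ^ 5 + \<gamma>) + 5 * (- (\<alpha> ^ 5) - 7 * (\<gamma> ^ 5 + \<gamma>))"
    by algebra
  finally have \<alpha>: "\<alpha> = 2 * (\<gamma> + \<delta>)"
    using root by simp
  have square: "\<psi> (\<gamma> * m ^ 3 * z ^ 6 + \<alpha> * m * z\<^sup>2) = \<psi> (2 * \<gamma> * m * (m\<^sup>2 * z ^ 5 - z)\<^sup>2)" for m z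
  proof -
    have "(2 * \<delta> * m * z\<^sup>2) ^ 5 = 2 * \<gamma> * m ^ 5 * z ^ 10 + 5 * (6 * \<gamma> * m ^ 5 * z ^ 10)"
      unfolding \<delta> by algebra
    then have twist: "\<psi> (2 * \<delta> * m * z\<^sup>2) = \<psi> (2 * \<gamma> * m ^ 5 * z ^ 10)"
      using frobenius[of "2 * \<delta> * m * z\<^sup>2"] by simp
    have "\<gamma> * m ^ 3 * z ^ 6 + \<alpha> * m * z\<^sup>2 = (\<gamma> * m ^ 3 * z ^ 6 + 2 * \<gamma> * m * z\<^sup>2) + 2 * \<delta> * m * z\<^sup>2"
      unfolding \<alpha> by algebra
    then have "\<psi> (\<gamma> * m ^ 3 * z ^ 6 + \<alpha> * m * z\<^sup>2) =
        \<psi> ((\<gamma> * m ^ 3 * z ^ 6 + 2 * \<gamma> * m * z\<^sup>2) + 2 * \<gamma> * m ^ 5 * z ^ 10)"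
      by (simp only: add[of "_ + _" "2 * \<delta> * m * z\<^sup>2"] twist add[of "_ + _" "2 * \<gamma> * m ^ 5 * z ^ 10"])
    also have "(\<gamma> * m ^ 3 * z ^ 6 + 2 * \<gamma> * m * z\<^sup>2) + 2 * \<gamma> * m ^ 5 * z ^ 10 =
        2 * \<gamma> * m * (m\<^sup>2 * z ^ 5 - z)\<^sup>2 + 5 * (\<gamma> * m ^ 3 * z ^ 6)"
      by algebra
    finally show ?thesis by simp
  qed
  have "(\<Sum>z\<in>UNIV. \<psi> (\<gamma> * n ^ 3 * z ^ 6 + \<alpha> * n * z\<^sup>2)) = gauss_sum (2 * \<gamma> * n)"
    unfolding square gauss_sum_def
    using sum.reindex_bij_betw[OF bij_nonsquare_artin_schreier[OF n], of "\<lambda>y. \<psi> (2 * \<gamma> * n * y\<^sup>2)"]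
    by simp
  also have "\<dots> = - gauss_sum (2 * \<gamma>)"
    by (rule gauss_sum_nonsquare[OF \<kappa> n])
  finally have twisted: "(\<Sum>z\<in>UNIV. \<psi> (\<gamma> * n ^ 3 * z ^ 6 + \<alpha> * n * z\<^sup>2)) = - gauss_sum (2 * \<gamma>)" .
  have "(\<Sum>z\<in>UNIV. \<psi> (\<gamma> * z ^ 6 + \<alpha> * z\<^sup>2)) = (\<Sum>z\<in>UNIV. \<psi> (2 * \<gamma> * (z ^ 5 - z)\<^sup>2))"
    using square[of 1] by simp
  note untwisted = this[unfolded sum_square_artin_schreier[OF \<kappa>]]
  have "2 * (\<Sum>x\<in>UNIV. \<psi> (\<gamma> * x ^ 3 + \<alpha> * x)) =
      2 * (gauss_sum (2 * \<gamma>) * (\<psi> (1 / (2 * \<gamma>)) + \<psi> (1 / (2 * \<gamma>)) ^ 4))"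
    unfolding cubic_sum_eq_sextic_sums[OF n, symmetric] twisted untwisted
    by (simp add: algebra_simps)
  then show ?thesis
    by simp
qed

text \<open>The values \<open>x = z\<^sup>2\<close> and \<open>x = n * z\<^sup>2\<close> account for the radicals of both quadratic
  forms, so the assumption makes both nondegenerate.\<close>

lemma cubic_sum_nondegenerate:
  assumes "\<gamma> \<noteq> 0" and nondeg: "\<And>x. x \<noteq> 0 \<Longrightarrow> \<gamma> ^ 5 * x ^ 12 + 2 * \<alpha> ^ 5 * x\<^sup>2 + \<gamma> \<noteq> 0"
  shows "\<exists>t\<in>{0, 1, - 1}. (\<Sum>x\<in>UNIV. \<psi> (\<gamma> * x ^ 3 + \<alpha> * x)) = of_real (sqrt (real CARD('a))) * t"
proof -
  let ?s = "of_real (sqrt (real CARD('a))) :: complex"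
  have root: "Q = ?s \<or> Q = - ?s" if "Q\<^sup>2 = of_nat CARD('a)" for Q
    using that by (simp flip: power2_eq_iff of_real_power)
  obtain n :: 'a where n: "\<And>y. n \<noteq> y\<^sup>2"
    using nonsquare_exists small_nonzero_five[OF five] by blast
  then have "n \<noteq> 0" by (metis zero_power2)
  have 1: "(\<Sum>z\<in>UNIV. \<psi> (\<gamma> * z ^ 6 + \<alpha> * z\<^sup>2))\<^sup>2 = of_nat CARD('a)"
  proof (rule sextic_sum_square)
    fix z :: 'a assume "z \<noteq> 0"
    then show "\<gamma> ^ 5 * z ^ 24 + 2 * \<alpha> ^ 5 * z ^ 4 + \<gamma> \<noteq> 0"
      using nondeg[of "z\<^sup>2"] by (simp flip: power_mult)
  qed
  have 2: "(\<Sum>z\<in>UNIV. \<psi> (\<gamma> * n ^ 3 * z ^ 6 + \<alpha> * n * z\<^sup>2))\<^sup>2 = of_nat CARD('a)"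
  proof (rule sextic_sum_square)
    fix z :: 'a assume "z \<noteq> 0"
    have "(\<gamma> * n ^ 3) ^ 5 * z ^ 24 + 2 * (\<alpha> * n) ^ 5 * z ^ 4 + \<gamma> * n ^ 3 =
        n ^ 3 * (\<gamma> ^ 5 * (n * z\<^sup>2) ^ 12 + 2 * \<alpha> ^ 5 * (n * z\<^sup>2)\<^sup>2 + \<gamma>)"
      by algebra
    then show "(\<gamma> * n ^ 3) ^ 5 * z ^ 24 + 2 * (\<alpha> * n) ^ 5 * z ^ 4 + \<gamma> * n ^ 3 \<noteq> 0"
      using nondeg[of "n * z\<^sup>2"] \<open>z \<noteq> 0\<close> \<open>n \<noteq> 0\<close> by simp
  qed
  let ?S = "\<Sum>x\<in>UNIV. \<psi> (\<gamma> * x ^ 3 + \<alpha> * x)"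
  have "2 * ?S = 2 * ?s \<or> 2 * ?S = 0 \<or> 2 * ?S = - (2 * ?s)"
    using root[OF 1] root[OF 2] unfolding cubic_sum_eq_sextic_sums[OF n, symmetric] by auto
  then have "?S = ?s * 1 \<or> ?S = ?s * 0 \<or> ?S = ?s * - 1"
    by (simp add: minus_equation_iff[of "2 * _"] flip: mult_minus_right)
  then show ?thesis by blast
qed

text \<open>The two preceding lemmas combine: \<open>t\<close> is \<open>0\<close>, \<open>1\<close>, \<open>- 1\<close>,
  or up to sign the sum of a fifth root of unity and its inverse.\<close>

lemma cubic_sum:
  assumes "\<gamma> \<noteq> 0"
  obtains t where
    "(\<Sum>x\<in>UNIV. \<psi> (\<gamma> * x ^ 3 + \<alpha> * x)) = of_real (sqrt (real CARD('a))) * t"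
    "\<And>w. w\<^sup>2 + t * w + 1 = 0 \<Longrightarrow> w ^ 60 = 1"
proof (cases "\<exists>x. x \<noteq> 0 \<and> \<gamma> ^ 5 * x ^ 12 + 2 * \<alpha> ^ 5 * x\<^sup>2 + \<gamma> = 0")
  case False
  then obtain t where t: "t \<in> {0, 1, - 1}"
    "(\<Sum>x\<in>UNIV. \<psi> (\<gamma> * x ^ 3 + \<alpha> * x)) = of_real (sqrt (real CARD('a))) * t"
    using cubic_sum_nondegenerate[OF assms, of \<alpha>] by blast
  show ?thesis
  proof (rule that[OF t(2)])
    fix w assume w: "w\<^sup>2 + t * w + 1 = 0"
    from t(1) have "w ^ 12 = 1"
    proof safe
      assume "t = 0"
      with w have "w\<^sup>2 = - 1" by (simp add: add_eq_0_iff2)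
      then have "(w\<^sup>2) ^ 6 = 1" by simp
      then show ?thesis by (simp flip: power_mult)
    next
      assume "t = 1"
      then have "w ^ 3 = 1" using w by algebra
      then have "(w ^ 3) ^ 4 = 1" by simp
      then show ?thesis by (simp flip: power_mult)
    next
      assume "t = - 1"
      then have "w ^ 3 = - 1" using w by algebra
      then have "(w ^ 3) ^ 4 = 1" by simp
      then show ?thesis by (simp flip: power_mult)
    qed
    then have "(w ^ 12) ^ 5 = 1" by simp
    then show "w ^ 60 = 1" by (simp flip: power_mult)
  qed
next
  case True
  then obtain a where a: "a \<noteq> 0" "\<gamma> ^ 5 * a ^ 12 + 2 * \<alpha> ^ 5 * a\<^sup>2 + \<gamma> = 0"
    by blast
  \<comment> \<open>replacing \<open>x\<close> by \<open>a * x\<close> moves the root to \<open>1\<close>\<close>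
  define \<gamma>' \<alpha>' where "\<gamma>' = \<gamma> * a ^ 3" and "\<alpha>' = \<alpha> * a"
  define \<theta> where "\<theta> = \<psi> (1 / (2 * \<gamma>'))"
  have "\<gamma>' ^ 5 + 2 * \<alpha>' ^ 5 + \<gamma>' = a ^ 3 * (\<gamma> ^ 5 * a ^ 12 + 2 * \<alpha> ^ 5 * a\<^sup>2 + \<gamma>)"
    unfolding \<gamma>'_def \<alpha>'_def by algebra
  then have deg: "\<gamma>' ^ 5 + 2 * \<alpha>' ^ 5 + \<gamma>' = 0"
    by (simp add: a)
  have \<gamma>': "\<gamma>' \<noteq> 0" using assms a by (simp add: \<gamma>'_def)
  have "(\<Sum>x\<in>UNIV. \<psi> (\<gamma> * x ^ 3 + \<alpha> * x)) = (\<Sum>x\<in>UNIV. \<psi> (\<gamma>' * x ^ 3 + \<alpha>' * x))"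
    by (rule sum.reindex_bij_witness[of _ "\<lambda>x. a * x" "\<lambda>x. x / a"])
       (use a in \<open>auto simp: \<gamma>'_def \<alpha>'_def power_divide power_mult_distrib\<close>)
  also have "\<dots> = gauss_sum (2 * \<gamma>') * (\<theta> + \<theta> ^ 4)"
    unfolding \<theta>_def by (rule cubic_sum_degenerate[OF \<gamma>' deg])
  finally have S: "(\<Sum>x\<in>UNIV. \<psi> (\<gamma> * x ^ 3 + \<alpha> * x)) = gauss_sum (2 * \<gamma>') * (\<theta> + \<theta> ^ 4)" .
  have "(gauss_sum (2 * \<gamma>'))\<^sup>2 = (of_real (sqrt (real CARD('a))))\<^sup>2"
    using gauss_sum_square[of "2 * \<gamma>'"] \<gamma>' small_nonzero_five[OF five] by (simp flip: of_real_power)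
  then obtain \<epsilon> where \<epsilon>: "\<epsilon> = 1 \<or> \<epsilon> = - 1" "gauss_sum (2 * \<gamma>') = of_real (sqrt (real CARD('a))) * \<epsilon>"
    using that by (metis mult.right_neutral mult_minus_right power2_eq_iff)
  have "\<theta> ^ 5 = 1"
    by (simp add: \<theta>_def fifth_power)
  show ?thesis
  proof (rule that[of "\<epsilon> * (\<theta> + \<theta> ^ 4)"])
    show "(\<Sum>x\<in>UNIV. \<psi> (\<gamma> * x ^ 3 + \<alpha> * x)) =
        of_real (sqrt (real CARD('a))) * (\<epsilon> * (\<theta> + \<theta> ^ 4))"
      by (simp add: S \<epsilon>(2))
  next
    fix w assume w: "w\<^sup>2 + \<epsilon> * (\<theta> + \<theta> ^ 4) * w + 1 = 0"
    \<comment> \<open>the roots are \<open>- \<epsilon> * \<theta>\<close> and \<open>- \<epsilon> * \<theta> ^ 4\<close>, since \<open>\<theta> ^ 5 = 1\<close>\<close>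
    have "\<epsilon>\<^sup>2 = 1" using \<epsilon>(1) by auto
    have "(w + \<epsilon> * \<theta>) * (w + \<epsilon> * \<theta> ^ 4) = w\<^sup>2 + \<epsilon> * (\<theta> + \<theta> ^ 4) * w + \<epsilon>\<^sup>2 * \<theta> ^ 5"
      by algebra
    also have "\<dots> = 0"
      using w by (simp add: \<open>\<epsilon>\<^sup>2 = 1\<close> \<open>\<theta> ^ 5 = 1\<close>)
    finally have "w = - \<epsilon> * \<theta> \<or> w = - \<epsilon> * \<theta> ^ 4"
      by (simp add: add_eq_0_iff2)
    moreover have "\<theta> ^ 60 = 1" "(\<theta> ^ 4) ^ 60 = 1"
      using arg_cong[OF \<open>\<theta> ^ 5 = 1\<close>, of "\<lambda>u. u ^ 12"] arg_cong[OF \<open>\<theta> ^ 5 = 1\<close>, of "\<lambda>u. u ^ 48"]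
      by (simp_all flip: power_mult)
    ultimately show "w ^ 60 = 1"
      using \<epsilon>(1) by (auto simp: power_mult_distrib)
  qed
qed

end

section \<open>Short interval characters\<close>

lemma short_charsD:
  assumes "\<chi> \<in> short_chars l"
  shows short_char_mult: "\<And>A B. A \<in> monic_polys \<Longrightarrow> B \<in> monic_polys \<Longrightarrow> \<chi> (A * B) = \<chi> A * \<chi> B"
    and short_char_cong: "\<And>A B. (A, B) \<in> short_rel l \<Longrightarrow> \<chi> A = \<chi> B"
    and short_char_nonzero: "\<And>A. A \<in> monic_polys \<Longrightarrow> \<chi> A \<noteq> 0"
    and short_char_extensional: "\<chi> \<in> extensional monic_polys"
proof -
  from assms obtain \<psi> where \<psi>: "\<psi> \<in> hom (class_group l) complex_units"
    and \<chi>: "\<chi> = compose monic_polys \<psi> (\<lambda>f. short_rel l `` {f})"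
    unfolding short_chars_def by blast
  have carrier: "short_rel l `` {A} \<in> carrier (class_group l)" if "A \<in> monic_polys" for A :: "'a poly"
    using that by (simp add: class_group_def quotientI)
  have eval: "\<chi> A = \<psi> (short_rel l `` {A})" if "A \<in> monic_polys" for A
    using that by (simp add: \<chi> compose_eq)
  have monic_mult: "A * B \<in> monic_polys" if "A \<in> monic_polys" "B \<in> monic_polys" for A B :: "'a poly"
    using that by (simp add: monic_polys_def lead_coeff_mult)
  show "\<chi> (A * B) = \<chi> A * \<chi> B" if "A \<in> monic_polys" "B \<in> monic_polys" for A B
    using hom_mult[OF \<psi> carrier carrier, OF that]
    by (simp add: eval monic_mult that class_mult complex_units_def)
  show "\<chi> A = \<chi> B" if "(A, B) \<in> short_rel l" for A B
    using that equiv_class_eq[OF equiv_short_rel that] by (simp add: eval short_rel_iff)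
  show "\<chi> A \<noteq> 0" if "A \<in> monic_polys" for A
    using hom_in_carrier[OF \<psi> carrier[OF that]] by (simp add: eval that complex_units_def)
  show "\<chi> \<in> extensional monic_polys"
    unfolding \<chi> by (rule compose_extensional)
qed

text \<open>Characters of the class group are exactly the functions on monic polynomials with the
  properties in lemma \<open>short_charsD\<close>.\<close>

lemma short_charsI:
  fixes \<chi> :: "'a::{field,finite} poly \<Rightarrow> complex"
  assumes mult: "\<And>A B. A \<in> monic_polys \<Longrightarrow> B \<in> monic_polys \<Longrightarrow> \<chi> (A * B) = \<chi> A * \<chi> B"
    and cong: "\<And>A B. (A, B) \<in> short_rel l \<Longrightarrow> \<chi> A = \<chi> B"
    and nonzero: "\<And>A. A \<in> monic_polys \<Longrightarrow> \<chi> A \<noteq> 0"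
    and ext: "\<chi> \<in> extensional monic_polys"
  shows "\<chi> \<in> short_chars l"
proof -
  define \<psi> where "\<psi> X = \<chi> (SOME f. f \<in> X)" for X
  have eval: "\<psi> (short_rel l `` {A}) = \<chi> A" if "A \<in> monic_polys" for A
  proof -
    have "A \<in> short_rel l `` {A}"
      using equiv_class_self[OF equiv_short_rel that] .
    then have "(SOME f. f \<in> short_rel l `` {A}) \<in> short_rel l `` {A}"
      by (rule someI)
    then show ?thesis
      using cong by (simp add: \<psi>_def)
  qed
  have monic_mult: "A * B \<in> monic_polys" if "A \<in> monic_polys" "B \<in> monic_polys" for A B :: "'a poly"
    using that by (simp add: monic_polys_def lead_coeff_mult)
  have carrier: "\<exists>A\<in>monic_polys. X = short_rel l `` {A}" if "X \<in> carrier (class_group l)"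
    for X :: "'a poly set"
    using that by (auto simp: class_group_def elim: quotientE)
  have "\<psi> \<in> hom (class_group l) complex_units"
  proof (rule homI)
    fix X :: "'a poly set" assume "X \<in> carrier (class_group l)"
    then show "\<psi> X \<in> carrier complex_units"
      using carrier[of X] eval nonzero by (auto simp: complex_units_def)
  next
    fix X Y :: "'a poly set" assume "X \<in> carrier (class_group l)" "Y \<in> carrier (class_group l)"
    then obtain A B where AB: "A \<in> monic_polys" "B \<in> monic_polys"
      "X = short_rel l `` {A}" "Y = short_rel l `` {B}"
      using carrier by meson
    then show "\<psi> (X \<otimes>\<^bsub>class_group l\<^esub> Y) = \<psi> X \<otimes>\<^bsub>complex_units\<^esub> \<psi> Y"
      by (simp add: class_mult eval mult monic_mult complex_units_def)
  qed
  moreover have "\<chi> = compose monic_polys \<psi> (\<lambda>f. short_rel l `` {f})"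
    using ext by (auto simp: compose_def extensional_def eval fun_eq_iff)
  ultimately show ?thesis
    unfolding short_chars_def by blast
qed

text \<open>The monic cubic with prescribed next-to-leading coefficients. These cubics represent the
  classes modulo the relation of level three.\<close>

definition monic_cubic :: "'a::{field,finite} \<Rightarrow> 'a \<Rightarrow> 'a \<Rightarrow> 'a poly" where
  "monic_cubic a b c = [:c, b, a, 1:]"

lemma monic_cubic_in_monic_polys [simp]: "monic_cubic a b c \<in> monic_polys"
  by (simp add: monic_cubic_def monic_polys_def)

lemma next_coeff_monic_cubic [simp]:
  "next_coeff (Suc 0) (monic_cubic a b c) = a"
  "next_coeff 2 (monic_cubic a b c) = b"
  "next_coeff 3 (monic_cubic a b c) = c"
  by (simp_all add: next_coeff_def monic_cubic_def numeral_eq_Suc)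

lemma short_rel_3_iff:
  "(A, B) \<in> short_rel 3 \<longleftrightarrow> A \<in> monic_polys \<and> B \<in> monic_polys \<and>
     next_coeff 1 A = next_coeff 1 B \<and> next_coeff 2 A = next_coeff 2 B \<and> next_coeff 3 A = next_coeff 3 B"
proof -
  have "{1..3::nat} = {1, 2, 3}" by auto
  then show ?thesis by (auto simp: short_rel_def)
qed

lemma next_coeff_mult:
  assumes "A \<in> monic_polys" "B \<in> monic_polys"
  shows "next_coeff (Suc 0) (A * B) = next_coeff 1 A + next_coeff 1 B"
    and "next_coeff 2 (A * B) = next_coeff 2 A + next_coeff 1 A * next_coeff 1 B + next_coeff 2 B"
    and "next_coeff 3 (A * B) =
      next_coeff 3 A + next_coeff 2 A * next_coeff 1 B + next_coeff 1 A * next_coeff 2 B + next_coeff 3 B"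
proof -
  have "next_coeff 0 A = 1" "next_coeff 0 B = 1"
    using assms by (simp_all add: next_coeff_def monic_polys_def)
  moreover have "next_coeff j (A * B) = (\<Sum>i\<le>j. next_coeff i A * next_coeff (j - i) B)" for j
    by (simp add: next_coeff_eq_reflect reflect_poly_mult coeff_mult)
  ultimately show "next_coeff (Suc 0) (A * B) = next_coeff 1 A + next_coeff 1 B"
    "next_coeff 2 (A * B) = next_coeff 2 A + next_coeff 1 A * next_coeff 1 B + next_coeff 2 B"
    "next_coeff 3 (A * B) =
      next_coeff 3 A + next_coeff 2 A * next_coeff 1 B + next_coeff 1 A * next_coeff 2 B + next_coeff 3 B"
    by (simp_all add: numeral_2_eq_2 numeral_3_eq_3 add_ac)
qed

lemma short_char_eq_cubic:
  assumes "\<chi> \<in> short_chars 3" "f \<in> monic_polys"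
  shows "\<chi> f = \<chi> (monic_cubic (next_coeff 1 f) (next_coeff 2 f) (next_coeff 3 f))"
  by (rule short_char_cong[OF assms(1)]) (simp add: short_rel_3_iff assms(2))

lemma short_char_cubic_mult:
  assumes "\<chi> \<in> short_chars 3"
  shows "\<chi> (monic_cubic a b c) * \<chi> (monic_cubic a' b' c') =
    \<chi> (monic_cubic (a + a') (b + a * a' + b') (c + b * a' + a * b' + c'))"
proof -
  let ?f = "monic_cubic a b c" and ?g = "monic_cubic a' b' c'"
  have "?f * ?g \<in> monic_polys"
    using monic_cubic_in_monic_polys[of a b c] monic_cubic_in_monic_polys[of a' b' c']
    unfolding monic_polys_def mem_Collect_eq by (simp add: lead_coeff_mult)
  from short_char_eq_cubic[OF assms this] show ?thesis
    by (simp add: short_char_mult[OF assms] next_coeff_mult)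
qed

text \<open>Polynomials that agree modulo the relation of level two differ, modulo that of level three, by
  a factor \<open>monic_cubic 0 0 c\<close>.\<close>

lemma short_char_nontrivial_on_top:
  assumes "\<chi> \<in> short_chars 3 - short_chars 2"
  shows "\<exists>c. \<chi> (monic_cubic 0 0 c) \<noteq> 1"
proof (rule ccontr)
  assume "\<nexists>c. \<chi> (monic_cubic 0 0 c) \<noteq> 1"
  then have triv: "\<chi> (monic_cubic 0 0 c) = 1" for c by blast
  have \<chi>: "\<chi> \<in> short_chars 3" using assms by blast
  have "\<chi> \<in> short_chars 2"
  proof (rule short_charsI)
    fix A B :: "'a poly" assume AB: "(A, B) \<in> short_rel 2"
    have "\<chi> A = \<chi> (monic_cubic (next_coeff 1 A) (next_coeff 2 A) (next_coeff 3 A)) *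
        \<chi> (monic_cubic 0 0 (next_coeff 3 B - next_coeff 3 A))"
      using AB short_char_eq_cubic[OF \<chi>, of A] by (simp add: triv short_rel_iff)
    also have "\<dots> = \<chi> (monic_cubic (next_coeff 1 B) (next_coeff 2 B) (next_coeff 3 B))"
      using AB by (simp add: short_char_cubic_mult[OF \<chi>] short_rel_def)
    also have "\<dots> = \<chi> B"
      using AB short_char_eq_cubic[OF \<chi>, of B] by (simp add: short_rel_iff)
    finally show "\<chi> A = \<chi> B" .
  qed (use short_charsD[OF \<chi>] in auto)
  with assms show False by blast
qed

text \<open>In characteristic five the truncated exponential and logarithm up to third order are
  defined; they identify the group of classes with the direct product of three copies of the additive
  group.\<close>

lemma short_char_via_logarithm:
  fixes \<chi> :: "'a::{field,finite} poly \<Rightarrow> complex"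
  assumes "CARD('a) = 5 ^ r" and "r \<ge> 1" and \<chi>: "\<chi> \<in> short_chars 3 - short_chars 2"
  obtains \<psi> :: "'a \<Rightarrow> complex" and k h g where "frobenius_character \<psi>" and "g \<noteq> 0"
    and "\<And>a b c. \<chi> (monic_cubic a b c) =
      \<psi> (k * a + h * (b + 2 * a\<^sup>2) + g * (c - a * b + 2 * a ^ 3))"
proof -
  note five = five_eq_0[OF assms(1)]
  have \<chi>3: "\<chi> \<in> short_chars 3" using \<chi> by blast
  note mult = short_char_cubic_mult[OF \<chi>3]
  have one: "\<chi> (monic_cubic 0 0 0) = 1"
    using mult[of 0 0 0 0 0 0] short_char_nonzero[OF \<chi>3, of "monic_cubic 0 0 0"] by simp
  define \<phi>\<^sub>1 \<phi>\<^sub>2 \<phi>\<^sub>3 where "\<phi>\<^sub>1 a = \<chi> (monic_cubic a (3 * a\<^sup>2) (a ^ 3))"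
    and "\<phi>\<^sub>2 a = \<chi> (monic_cubic 0 a 0)" and "\<phi>\<^sub>3 a = \<chi> (monic_cubic 0 0 a)" for a
  \<comment> \<open>\<open>\<phi>\<^sub>1\<close> is the value at the truncated exponential, as \<open>1 / 2 = 3\<close> and \<open>1 / 6 = 1\<close>\<close>
  have char\<^sub>1: "additive_character \<phi>\<^sub>1"
  proof
    fix x y :: 'a
    have "3 * x\<^sup>2 + x * y + 3 * y\<^sup>2 + 5 * (x * y) = 3 * (x + y)\<^sup>2"
      "x ^ 3 + 3 * x\<^sup>2 * y + x * (3 * y\<^sup>2) + y ^ 3 = (x + y) ^ 3"
      by algebra+
    then show "\<phi>\<^sub>1 (x + y) = \<phi>\<^sub>1 x * \<phi>\<^sub>1 y"
      by (simp add: \<phi>\<^sub>1_def mult five)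
  qed (simp add: \<phi>\<^sub>1_def one)
  have char\<^sub>2: "additive_character \<phi>\<^sub>2" and char\<^sub>3: "additive_character \<phi>\<^sub>3"
    by unfold_locales (simp_all add: \<phi>\<^sub>2_def \<phi>\<^sub>3_def mult one)
  have decompose: "\<chi> (monic_cubic a b c) = \<phi>\<^sub>1 a * \<phi>\<^sub>2 (b + 2 * a\<^sup>2) * \<phi>\<^sub>3 (c - a * b + 2 * a ^ 3)" for a b c
  proof -
    have "3 * a\<^sup>2 + (b + 2 * a\<^sup>2) = b + 5 * a\<^sup>2"
      "a ^ 3 + a * (b + 2 * a\<^sup>2) + (c - a * b + 2 * a ^ 3) = c + 5 * a ^ 3"
      by algebra+
    then have "3 * a\<^sup>2 + (b + 2 * a\<^sup>2) = b"
      "a ^ 3 + a * (b + 2 * a\<^sup>2) + (c - a * b + 2 * a ^ 3) = c"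
      by (simp_all only: five mult_zero_left add_0_right)
    then show ?thesis
      by (simp only: \<phi>\<^sub>1_def \<phi>\<^sub>2_def \<phi>\<^sub>3_def mult mult_zero_left mult_zero_right add_0_left add_0_right)
  qed
  obtain y where y: "\<phi>\<^sub>3 y \<noteq> 1"
    using short_char_nontrivial_on_top[OF \<chi>] by (auto simp: \<phi>\<^sub>3_def)
  obtain \<psi> :: "'a \<Rightarrow> complex" where "frobenius_character \<psi>"
    using frobenius_character_exists[OF assms(1,2) char\<^sub>3 y] .
  interpret frobenius_character \<psi> by fact
  obtain k h g where kgh: "\<And>x. \<phi>\<^sub>1 x = \<psi> (k * x)" "\<And>x. \<phi>\<^sub>2 x = \<psi> (h * x)" "\<And>x. \<phi>\<^sub>3 x = \<psi> (g * x)"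
    using additive_character_scaled char\<^sub>1 char\<^sub>2 char\<^sub>3 by metis
  show ?thesis
  proof (rule that)
    show "g \<noteq> 0" using y kgh(3)[of y] by auto
    show "\<chi> (monic_cubic a b c) = \<psi> (k * a + h * (b + 2 * a\<^sup>2) + g * (c - a * b + 2 * a ^ 3))" for a b c
      by (simp add: decompose kgh add)
  qed fact
qed

section \<open>The L-function\<close>

lemma monic_degree_0: "{f. f \<in> (monic_polys :: 'a::{field,finite} poly set) \<and> degree f = 0} = {1}"
  by (auto simp: monic_polys_def one_pCons elim!: degree_eq_zeroE)

lemma monic_degree_1:
  "bij_betw (\<lambda>a. [:a, 1:]) UNIV {f. f \<in> (monic_polys :: 'a::{field,finite} poly set) \<and> degree f = 1}"
proof (rule bij_betw_byWitness[where f' = "\<lambda>f. coeff f 0"])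
  show "\<forall>f\<in>{f. f \<in> (monic_polys :: 'a poly set) \<and> degree f = 1}. [:coeff f 0, 1:] = f"
  proof
    fix f assume f: "f \<in> {f. f \<in> (monic_polys :: 'a poly set) \<and> degree f = 1}"
    show "[:coeff f 0, 1:] = f"
    proof (rule poly_eqI)
      fix i
      show "coeff [:coeff f 0, 1:] i = coeff f i"
        using f by (cases "i \<le> 1") (auto simp: monic_polys_def coeff_pCons coeff_eq_0 le_Suc_eq split: nat.split)
    qed
  qed
qed (auto simp: monic_polys_def)

lemma monic_degree_2:
  "bij_betw (\<lambda>(a, b). [:b, a, 1:]) UNIV {f. f \<in> (monic_polys :: 'a::{field,finite} poly set) \<and> degree f = 2}"
proof (rule bij_betw_byWitness[where f' = "\<lambda>f. (coeff f 1, coeff f 0)"])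
  show "\<forall>f\<in>{f. f \<in> (monic_polys :: 'a poly set) \<and> degree f = 2}. (case (coeff f 1, coeff f 0) of (a, b) \<Rightarrow> [:b, a, 1:]) = f"
  proof
    fix f assume f: "f \<in> {f. f \<in> (monic_polys :: 'a poly set) \<and> degree f = 2}"
    show "(case (coeff f 1, coeff f 0) of (a, b) \<Rightarrow> [:b, a, 1:]) = f"
      unfolding prod.case
    proof (rule poly_eqI)
      fix i
      show "coeff [:coeff f 0, coeff f 1, 1:] i = coeff f i"
        using f by (cases "i \<le> 2")
          (auto simp: monic_polys_def coeff_pCons coeff_eq_0 le_Suc_eq numeral_2_eq_2 split: nat.split)
    qed
  qed
qed (auto simp: monic_polys_def numeral_2_eq_2)

text \<open>Adding \<open>c\<close> to the third next-to-leading coefficient permutes the monic polynomials of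
  degree \<open>n\<close> and multiplies \<open>\<chi>\<close> by a constant other than \<open>1\<close>.\<close>

lemma L_series_nth_ge_3:
  assumes \<chi>: "\<chi> \<in> short_chars 3 - short_chars 2" and "n \<ge> 3"
  shows "fps_nth (L_series \<chi>) n = 0"
proof -
  have \<chi>3: "\<chi> \<in> short_chars 3" using \<chi> by blast
  obtain c where c: "\<chi> (monic_cubic 0 0 c) \<noteq> 1"
    using short_char_nontrivial_on_top[OF \<chi>] by blast
  let ?M = "{f. f \<in> monic_polys \<and> degree f = n}"
  define m where "m = monom c (n - 3)"
  have shift: "f + monom d (n - 3) \<in> ?M" if "f \<in> ?M" for f and d :: 'a
  proof -
    have "degree (monom d (n - 3)) < degree f"
      using that assms(2) by (intro le_less_trans[OF degree_monom_le]) auto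
    with that show ?thesis
      using assms(2) by (auto simp: monic_polys_def degree_add_eq_left)
  qed
  have "\<chi> (f + m) = \<chi> f * \<chi> (monic_cubic 0 0 c)" if "f \<in> ?M" for f
  proof -
    have coeffs: "next_coeff (Suc 0) (f + m) = next_coeff (Suc 0) f" "next_coeff 2 (f + m) = next_coeff 2 f"
      "next_coeff 3 (f + m) = next_coeff 3 f + c"
      using that shift[OF that, of c] assms(2) by (auto simp: m_def next_coeff_def)
    have "\<chi> (f + m) = \<chi> (monic_cubic (next_coeff 1 f) (next_coeff 2 f) (next_coeff 3 f + c))"
      using short_char_eq_cubic[OF \<chi>3, of "f + m"] shift[OF that, of c] by (simp add: coeffs m_def[symmetric])
    also have "\<dots> = \<chi> (monic_cubic (next_coeff 1 f) (next_coeff 2 f) (next_coeff 3 f)) * \<chi> (monic_cubic 0 0 c)"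
      by (simp add: short_char_cubic_mult[OF \<chi>3])
    finally show ?thesis
      using short_char_eq_cubic[OF \<chi>3, of f] that by simp
  qed
  moreover have "(\<Sum>f\<in>?M. \<chi> f) = (\<Sum>f\<in>?M. \<chi> (f + m))"
    by (rule sum.reindex_bij_witness[of _ "\<lambda>f. f + m" "\<lambda>f. f - m"])
      (use shift[of _ c] shift[of _ "- c"] in \<open>auto simp: m_def minus_monom[symmetric]\<close>)
  ultimately have "(\<Sum>f\<in>?M. \<chi> f) = (\<Sum>f\<in>?M. \<chi> f * \<chi> (monic_cubic 0 0 c))"
    by simp
  also have "\<dots> = (\<Sum>f\<in>?M. \<chi> f) * \<chi> (monic_cubic 0 0 c)"
    by (simp only: sum_distrib_right)
  finally have "(\<Sum>f\<in>?M. \<chi> f) = (\<Sum>f\<in>?M. \<chi> f) * \<chi> (monic_cubic 0 0 c)" .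
  with c show ?thesis
    by (simp add: L_series_def)
qed

lemma L_series_nth_0:
  assumes "\<chi> \<in> short_chars l"
  shows "fps_nth (L_series \<chi>) 0 = 1"
proof -
  have "\<chi> 1 * \<chi> 1 = \<chi> 1" "\<chi> 1 \<noteq> 0"
    using short_char_mult[OF assms, of 1 1] short_char_nonzero[OF assms, of 1]
    by (simp_all add: monic_polys_def)
  then show ?thesis
    by (simp add: L_series_def monic_degree_0)
qed

lemma L_series_nth_1:
  assumes "\<chi> \<in> short_chars 3"
  shows "fps_nth (L_series \<chi>) 1 = (\<Sum>a\<in>UNIV. \<chi> (monic_cubic a 0 0))"
proof -
  have "\<chi> [:a, 1:] = \<chi> (monic_cubic a 0 0)" for a
    using short_char_eq_cubic[OF assms, of "[:a, 1:]"] by (simp add: monic_polys_def next_coeff_def)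
  then show ?thesis
    using sum.reindex_bij_betw[OF monic_degree_1, of \<chi>] by (simp add: L_series_def)
qed

lemma L_series_nth_2:
  assumes "\<chi> \<in> short_chars 3"
  shows "fps_nth (L_series \<chi>) 2 = (\<Sum>a\<in>UNIV. \<Sum>b\<in>UNIV. \<chi> (monic_cubic a b 0))"
proof -
  have "\<chi> [:b, a, 1:] = \<chi> (monic_cubic a b 0)" for a b
    using short_char_eq_cubic[OF assms, of "[:b, a, 1:]"]
    by (simp add: monic_polys_def next_coeff_def numeral_2_eq_2)
  then show ?thesis
    using sum.reindex_bij_betw[OF monic_degree_2, of \<chi>]
    by (simp add: L_series_def sum.cartesian_product case_prod_unfold)
qed

context frobenius_character
begin

text \<open>The substitution \<open>a = x + s\<close> completes the cube: the coefficient of \<open>x\<^sup>2\<close> becomes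
  \<open>10 * g * s = 0\<close>.\<close>

lemma sum_shifted_cubic:
  "(\<Sum>a\<in>UNIV. \<psi> (k * a + 2 * g * s * (2 * a\<^sup>2) + g * (2 * a ^ 3))) =
    \<psi> (k * s + g * s ^ 3) * (\<Sum>x\<in>UNIV. \<psi> (2 * g * x ^ 3 + (k - g * s\<^sup>2) * x))"
proof -
  have "(\<Sum>a\<in>UNIV. \<psi> (k * a + 2 * g * s * (2 * a\<^sup>2) + g * (2 * a ^ 3))) =
      (\<Sum>x\<in>UNIV. \<psi> (k * (x + s) + 2 * g * s * (2 * (x + s)\<^sup>2) + g * (2 * (x + s) ^ 3)))"
    by (rule sum.reindex_bij_witness[of _ "\<lambda>x. x + s" "\<lambda>a. a - s"]) auto
  also have "\<dots> = (\<Sum>x\<in>UNIV. \<psi> ((k * s + g * s ^ 3) + (2 * g * x ^ 3 + (k - g * s\<^sup>2) * x)))"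
  proof (rule sum.cong[OF refl])
    fix x
    have "k * (x + s) + 2 * g * s * (2 * (x + s)\<^sup>2) + g * (2 * (x + s) ^ 3) =
        (k * s + g * s ^ 3) + (2 * g * x ^ 3 + (k - g * s\<^sup>2) * x) +
        5 * (2 * g * s * x\<^sup>2 + 3 * g * s\<^sup>2 * x + g * s ^ 3)"
      by algebra
    then show "\<psi> (k * (x + s) + 2 * g * s * (2 * (x + s)\<^sup>2) + g * (2 * (x + s) ^ 3)) =
        \<psi> ((k * s + g * s ^ 3) + (2 * g * x ^ 3 + (k - g * s\<^sup>2) * x))"
      by (simp only: five mult_zero_left add_0_right)
  qed
  finally show ?thesis
    by (simp only: add sum_distrib_left)
qed

text \<open>The exponent is affine in \<open>b\<close>, and only \<open>a = 2 * s\<close> makes its slope vanish.\<close>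

lemma sum_quadratic_coefficients:
  assumes "g \<noteq> 0"
  shows "(\<Sum>a\<in>UNIV. \<Sum>b\<in>UNIV. \<psi> (k * a + 2 * g * s * (b + 2 * a\<^sup>2) + g * (0 - a * b + 2 * a ^ 3))) =
    (\<psi> (k * s + g * s ^ 3))\<^sup>2 * of_nat CARD('a)"
proof -
  let ?f = "\<lambda>a. k * a + 2 * g * s * (2 * a\<^sup>2) + g * (2 * a ^ 3)"
  have "k * a + 2 * g * s * (b + 2 * a\<^sup>2) + g * (0 - a * b + 2 * a ^ 3) = ?f a + g * (2 * s - a) * b" for a b
    by algebra
  then have "(\<Sum>a\<in>UNIV. \<Sum>b\<in>UNIV. \<psi> (k * a + 2 * g * s * (b + 2 * a\<^sup>2) + g * (0 - a * b + 2 * a ^ 3))) =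
      (\<Sum>a\<in>UNIV. \<psi> (?f a) * (\<Sum>b\<in>UNIV. \<psi> (g * (2 * s - a) * b)))"
    by (simp only: add[of "?f _"] sum_distrib_left)
  also have "\<dots> = (\<Sum>a\<in>UNIV. if a = 2 * s then \<psi> (?f (2 * s)) * of_nat CARD('a) else 0)"
    using assms by (intro sum.cong refl) (auto simp: sum_linear)
  also have "\<dots> = \<psi> (?f (2 * s)) * of_nat CARD('a)"
    by simp
  also have "?f (2 * s) = (k * s + g * s ^ 3) + (k * s + g * s ^ 3)"
  proof (rule eq_by_five)
    show "?f (2 * s) = (k * s + g * s ^ 3) + (k * s + g * s ^ 3) + 5 * (6 * g * s ^ 3)"
      by algebra
  qed
  finally show ?thesis
    by (simp only: add[of "k * s + g * s ^ 3" "k * s + g * s ^ 3"] power2_eq_square)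
qed

end

theorem lemma4p2:
  fixes r :: nat and \<chi> :: "'a::{field,finite} poly \<Rightarrow> complex"
  assumes "r \<ge> 1"
    and "CARD('a) = 5 ^ r"
    and "\<chi> \<in> short_chars 3 - short_chars 2"
  shows "\<exists>P :: complex poly.
           fps_of_poly P = L_series \<chi> oo (fps_const (complex_of_real (1 / sqrt (real CARD('a)))) * fps_X)
           \<and> (\<forall>z. poly P z = 0 \<longrightarrow> z ^ 60 = 1)"
proof -
  have \<chi>: "\<chi> \<in> short_chars 3" using assms by blast
  obtain \<psi> :: "'a \<Rightarrow> complex" and k h g where "frobenius_character \<psi>" and g: "g \<noteq> 0"
    and log: "\<And>a b c. \<chi> (monic_cubic a b c) =
      \<psi> (k * a + h * (b + 2 * a\<^sup>2) + g * (c - a * b + 2 * a ^ 3))"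
    by (rule short_char_via_logarithm[OF assms(2,1,3)]) (rule that)
  interpret frobenius_character \<psi> by fact
  have "2 \<noteq> (0 :: 'a)" using small_nonzero_five[OF five] by simp
  \<comment> \<open>the shift that removes the quadratic term of the cubic\<close>
  define s where "s = h / (2 * g)"
  have h: "h = 2 * g * s"
    using g \<open>2 \<noteq> 0\<close> by (simp add: s_def)
  let ?q = "of_real (sqrt (real CARD('a))) :: complex"
  define \<eta> where "\<eta> = \<psi> (k * s + g * s ^ 3)"
  have \<eta>: "\<eta> ^ 5 = 1"
    by (simp add: \<eta>_def fifth_power)
  obtain t where t: "(\<Sum>x\<in>UNIV. \<psi> (2 * g * x ^ 3 + (k - g * s\<^sup>2) * x)) = ?q * t"
    "\<And>w. w\<^sup>2 + t * w + 1 = 0 \<Longrightarrow> w ^ 60 = 1"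
    using cubic_sum[of "2 * g" "k - g * s\<^sup>2"] g \<open>2 \<noteq> 0\<close> by auto
  have nth_1: "fps_nth (L_series \<chi>) 1 = \<eta> * (?q * t)"
    using sum_shifted_cubic[of k g s] unfolding L_series_nth_1[OF \<chi>] log h \<eta>_def t(1)[symmetric] by simp
  have nth_2: "fps_nth (L_series \<chi>) 2 = \<eta>\<^sup>2 * ?q\<^sup>2"
    using sum_quadratic_coefficients[OF g, of k s] unfolding L_series_nth_2[OF \<chi>] log h \<eta>_def
    by (simp flip: of_real_power)
  define P where "P = [:1, \<eta> * t, \<eta>\<^sup>2:]"
  show ?thesis
  proof (intro exI[of _ P] conjI allI impI)
    have "coeff P n = (1 / ?q) ^ n * fps_nth (L_series \<chi>) n" for n
    proof -
      consider "n = 0" | "n = 1" | "n = 2" | "n \<ge> 3" by linarith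
      then show ?thesis
      proof cases
        case 1
        then show ?thesis by (simp add: P_def L_series_nth_0[OF \<chi>])
      next
        case 2
        then show ?thesis unfolding 2 nth_1 by (simp add: P_def)
      next
        case 3
        then show ?thesis unfolding 3 nth_2 by (simp add: P_def numeral_2_eq_2 power_divide)
      next
        case 4
        then have "coeff P n = 0"
          by (intro coeff_eq_0) (auto simp: P_def)
        with 4 show ?thesis by (simp add: L_series_nth_ge_3[OF assms(3)])
      qed
    qed
    then show "fps_of_poly P =
        L_series \<chi> oo (fps_const (complex_of_real (1 / sqrt (real CARD('a)))) * fps_X)"
      by (intro fps_ext) simp
  next
    fix z assume "poly P z = 0"
    then have "(\<eta> * z)\<^sup>2 + t * (\<eta> * z) + 1 = 0"
      by (simp add: P_def algebra_simps power2_eq_square)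
    then have "(\<eta> * z) ^ 60 = 1"
      by (rule t(2))
    then have "\<eta> ^ 60 * z ^ 60 = 1"
      by (simp add: power_mult_distrib)
    moreover have "\<eta> ^ 60 = 1"
      using arg_cong[OF \<eta>, of "\<lambda>u. u ^ 12"] by (simp flip: power_mult)
    ultimately show "z ^ 60 = 1" by simp
  qed
qed

end
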